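(* Let $\mathbf P$ be an equiangular hedgehog with $n\ge3$ sides tangent to a hypocycloid $h$ of order $m$. Then the oriented angle bisector evolute $\mathcal A_o(\mathbf P)$ is tangent to the curve obtained from the evolute $\mathcal E(h)$ by scaling with the factor $\dfrac{\sin(\pi m/n)}{m\sin(\pi/n)}$ with respect to its center.
   Context: A cooriented line $(\alpha,p)$ is the line $x\cos\alpha+y\sin\alpha=p$ with coorienting normal $(\cos\alpha,\sin\alpha)$; it is oriented by the normal turned counterclockwise by $\pi/2$ (and conversely an orientation defines a coorientation). A cooriented $n$-gon is a cyclic sequence of cooriented lines $l_j=(\alpha_j,p_j)$ (indices mod $n$) with $l_j,l_{j+1}$ meeting at a single point. It is an equiangular hedgehog if all turning angles $\alpha_{j+1}-\alpha_j$ equal $2\pi/n$ modulo $2\pi$. If $l,l'$ are two crossing oriented lines with orienting unit vectors $e,e'$, the interior bisector of $\angle(l,l')$ is the line through their intersection point oriented by the vector $e'-e$. The oriented angle bisector evolute $\mathcal A_o(\mathbf P)$ of $\mathbf P=(l_1,\dots,l_n)$ is the cooriented polygon $(l^*_{1+\frac12},\dots,l^*_{n+\frac12})$, where $l^*_{j+\frac12}$ is the interior bisector of $\angle(l_j,l_{j+1})$. A smooth hedgehog is a cooriented closed wave front described by its $2\pi$-periodic support function $p(\alpha)$ (the signed distance from the origin to its tangent line with coorienting normal $(\cos\alpha,\sin\alpha)$). A hypocycloid of order $m$ centered at the origin is the hedgehog with support function $a\cos m\alpha+b\sin m\alpha$. The evolute $\mathcal E(h)$ is the envelope of the normals of $h$;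 its support function is $p'(\alpha-\pi/2)$ if that of $h$ is $p(\alpha)$. A cooriented line $(\alpha_j,p_j)$ is tangent to a hedgehog with support function $p$ if $p_j=p(\alpha_j)$; a polygon is tangent to the hedgehog if all its sides are. Scaling by a factor $c$ with respect to the center (taken as the origin) multiplies the support function by $c$. *)

theory Defs
  imports "HOL-Analysis.Analysis" "HOL-Library.Real_Mod"
begin

text \<open>The Euclidean plane is identified with \<^typ>\<open>complex\<close>.\<close>

section \<open>Cooriented lines and polygons\<close>

text \<open>The pair \<open>(\<alpha>, p)\<close> is the line \<open>x cos \<alpha> + y sin \<alpha> = p\<close> with coorienting normal \<open>cis \<alpha>\<close>.
  Pairs whose angles differ by a multiple of \<open>2 * pi\<close> represent the same cooriented line;
  all notions below are insensitive to the choice of the representative (tangency because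
  support functions are \<open>2 * pi\<close>-periodic).\<close>

type_synonym cline = "real \<times> real"

definition line_points :: "cline \<Rightarrow> complex set" where
  "line_points l = {z. Re z * cos (fst l) + Im z * sin (fst l) = snd l}"

definition orienting_vector :: "cline \<Rightarrow> complex" where
  "orienting_vector l = \<i> * cis (fst l)"

definition crossing :: "cline \<Rightarrow> cline \<Rightarrow> bool" where
  "crossing l l' \<longleftrightarrow> (\<exists>!z. z \<in> line_points l \<inter> line_points l')"

definition crossing_point :: "cline \<Rightarrow> cline \<Rightarrow> complex" where
  "crossing_point l l' = (THE z. z \<in> line_points l \<inter> line_points l')"

text \<open>A cyclic sequence is represented by a list, with indices taken modulo its length.\<close>

definition cooriented_polygon :: "cline list \<Rightarrow> bool" where
  "cooriented_polygon P \<longleftrightarrow>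
     (\<forall>j<length P. crossing (P ! j) (P ! (Suc j mod length P)))"

definition equiangular_hedgehog :: "cline list \<Rightarrow> bool" where
  "equiangular_hedgehog P \<longleftrightarrow> cooriented_polygon P \<and>
     (\<forall>j<length P. [fst (P ! (Suc j mod length P)) - fst (P ! j)
                      = 2 * pi / real (length P)] (rmod (2 * pi)))"

text \<open>The bisector is oriented by \<open>v = e' - e\<close>; its coorienting normal is therefore \<open>v\<close> turned
  clockwise by a right angle, i.e. multiplied by \<open>- \<i>\<close>.\<close>

definition interior_bisector :: "cline \<Rightarrow> cline \<Rightarrow> cline" where
  "interior_bisector l l' =
     (let z = crossing_point l l';
          v = orienting_vector l' - orienting_vector l;
          \<alpha> = Arg (- \<i> * v)
      in (\<alpha>, Re z * cos \<alpha> + Im z * sin \<alpha>))"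

definition oriented_bisector_evolute :: "cline list \<Rightarrow> cline list" where
  "oriented_bisector_evolute P =
     map (\<lambda>j. interior_bisector (P ! j) (P ! (Suc j mod length P))) [0..<length P]"

section \<open>Smooth hedgehogs, given by their support functions\<close>

type_synonym support_function = "real \<Rightarrow> real"

definition point_support :: "complex \<Rightarrow> support_function" where
  "point_support z \<alpha> = Re z * cos \<alpha> + Im z * sin \<alpha>"

text \<open>Translating a hedgehog by \<open>z\<close> adds \<^term>\<open>point_support z\<close> to its support function. Hence
  for \<open>z = 0\<close> the next two definitions are \<open>a cos m\<alpha> + b sin m\<alpha>\<close> and multiplication by \<open>c\<close>.\<close>

definition hypocycloid :: "nat \<Rightarrow> complex \<Rightarrow> support_function \<Rightarrow> bool" where
  "hypocycloid m z h \<longleftrightarrow>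
     (\<exists>a b. \<forall>\<alpha>. h \<alpha> = point_support z \<alpha> + (a * cos (real m * \<alpha>) + b * sin (real m * \<alpha>)))"

definition scale_about :: "complex \<Rightarrow> real \<Rightarrow> support_function \<Rightarrow> support_function" where
  "scale_about z c h = (\<lambda>\<alpha>. point_support z \<alpha> + c * (h \<alpha> - point_support z \<alpha>))"

text \<open>The envelope of the normals, each normal being cooriented by the tangent direction
  \<open>\<i> * cis \<alpha>\<close>, i.e. having normal angle \<open>\<alpha> + pi / 2\<close>.\<close>

definition evolute :: "support_function \<Rightarrow> support_function" where
  "evolute h = (\<lambda>\<alpha>. deriv h (\<alpha> - pi / 2))"

definition line_tangent_to :: "cline \<Rightarrow> support_function \<Rightarrow> bool" where
  "line_tangent_to l h \<longleftrightarrow> snd l = h (fst l)"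

definition polygon_tangent_to :: "cline list \<Rightarrow> support_function \<Rightarrow> bool" where
  "polygon_tangent_to P h \<longleftrightarrow> (\<forall>l\<in>set P. line_tangent_to l h)"

section \<open>Basic facts\<close>

lemma crossing_point_in:
  assumes "crossing l l'"
  shows "crossing_point l l' \<in> line_points l \<inter> line_points l'"
  using assms unfolding crossing_def crossing_point_def by (rule theI')

lemma crossing_imp_orienting_vector_neq:
  assumes "crossing l l'"
  shows "orienting_vector l \<noteq> orienting_vector l'"
proof
  assume "orienting_vector l = orienting_vector l'"
  then have eq: "cos (fst l) = cos (fst l')" "sin (fst l) = sin (fst l')"
    by (auto simp: orienting_vector_def complex_eq_iff)
  obtain z where z: "z \<in> line_points l \<inter> line_points l'"
    and uniq: "\<And>w. w \<in> line_points l \<inter> line_points l' \<Longrightarrow> w = z"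
    using assms unfolding crossing_def by blast
  have "z + orienting_vector l \<in> line_points l \<inter> line_points l'"
    using z eq by (auto simp: line_points_def orienting_vector_def algebra_simps)
  then have "orienting_vector l = 0"
    using uniq by force
  then show False
    by (simp add: orienting_vector_def)
qed

lemma crossing_point_in_interior_bisector:
  "crossing_point l l' \<in> line_points (interior_bisector l l')"
  by (simp add: line_points_def interior_bisector_def Let_def)

lemma orienting_vector_interior_bisector:
  assumes "crossing l l'"
  shows "orienting_vector (interior_bisector l l')
           = sgn (orienting_vector l' - orienting_vector l)"
proof -
  let ?v = "orienting_vector l' - orienting_vector l"
  have "- \<i> * ?v \<noteq> 0"
    using crossing_imp_orienting_vector_neq[OF assms] by simp
  then have "cis (Arg (- \<i> * ?v)) = sgn (- \<i> * ?v)"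
    by (rule cis_Arg)
  also have "\<dots> = - \<i> * sgn ?v"
    by (simp add: sgn_eq norm_mult del: mult_minus_left)
  finally show ?thesis
    by (simp add: orienting_vector_def interior_bisector_def Let_def)
qed

lemma hypocycloid_evolute:
  assumes "hypocycloid m z h"
  shows "hypocycloid m z (evolute h)"
proof -
  obtain a b where h: "h = (\<lambda>\<alpha>. point_support z \<alpha> + (a * cos (real m * \<alpha>) + b * sin (real m * \<alpha>)))"
    using assms unfolding hypocycloid_def by blast
  have d: "deriv h x = - Re z * sin x + Im z * cos x
             + (- a * real m * sin (real m * x) + b * real m * cos (real m * x))" for x
    unfolding h point_support_def
    by (rule DERIV_imp_deriv) (auto intro!: derivative_eq_intros)
  let ?s = "sin (real m * (pi / 2))" and ?c = "cos (real m * (pi / 2))"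
  have "evolute h \<alpha> = point_support z \<alpha> +
      ((a * real m * ?s + b * real m * ?c) * cos (real m * \<alpha>)
       + (- a * real m * ?c + b * real m * ?s) * sin (real m * \<alpha>))" for \<alpha>
    by (simp only: evolute_def d point_support_def right_diff_distrib sin_diff cos_diff)
       (simp add: algebra_simps)
  then show ?thesis
    unfolding hypocycloid_def by blast
qed

end

theory Submission
  imports Defs "HOL-Library.Periodic_Fun"
begin

text \<open>For sides \<open>(\<alpha>, p)\<close> and \<open>(\<alpha>', p')\<close> with \<open>\<alpha>' \<equiv> \<alpha> + 2\<delta>\<close>, the difference of the two
  normals is \<open>2 sin \<delta>\<close> times the unit vector of angle \<open>\<alpha> + \<delta> + \<pi>/2\<close>. Hence the interior bisector
  is the cooriented line of that angle and pedal distance \<open>(p' - p) / (2 sin \<delta>)\<close>. When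
  \<open>p = h \<alpha>\<close> and \<open>p' = h \<alpha>'\<close>, this is a central difference quotient of \<open>h\<close> at \<open>\<alpha> + \<delta>\<close>; applied
  to the harmonic of order \<open>m\<close>, it equals the derivative times \<open>sin (m \<delta>) / (m sin \<delta>)\<close>. The first
  harmonic, which encodes the center, has factor 1.\<close>

text \<open>Factoring out the midpoint \<open>cis (x + d)\<close> leaves a difference of conjugates,
  which is purely imaginary.\<close>

lemma cis_diff_half_angle:
  "cis (x + 2 * d) - cis x = of_real (2 * sin d) * cis (x + d + pi / 2)"
proof -
  have half: "cis d - cis (- d) = of_real (2 * sin d) * cis (pi / 2)"
    by (simp add: complex_eq_iff)
  have "cis (x + 2 * d) - cis x = cis (x + d) * (cis d - cis (- d))"
    by (simp add: right_diff_distrib cis_mult add.assoc)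
  also have "\<dots> = of_real (2 * sin d) * (cis (x + d) * cis (pi / 2))"
    unfolding half by (rule mult.left_commute)
  finally show ?thesis
    by (simp only: cis_mult)
qed

text \<open>Turning angles, and bisector angles chosen by \<open>Arg\<close>, are known only modulo
  \<open>2 * pi\<close>; this carries support values across representatives.\<close>

lemma rcong_imp_periodic_eq:
  fixes f :: "real \<Rightarrow> 'a"
  assumes "\<And>x. f (x + p) = f x" and "[x = y] (rmod p)"
  shows "f x = f y"
proof -
  interpret periodic_fun_simple f p
    by standard (rule assms(1))
  show ?thesis
    using assms(2) by (auto simp: rcong_altdef plus_of_int)
qed

lemma interior_bisector_of_turning_angle:
  assumes cross: "crossing l l'"
    and turn: "[fst l' - fst l = 2 * d] (rmod (2 * pi))"
    and pos: "sin d > 0"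
  shows "[fst (interior_bisector l l') = fst l + d + pi / 2] (rmod (2 * pi))"
    and "snd (interior_bisector l l') = (snd l' - snd l) / (2 * sin d)"
proof -
  let ?\<theta> = "fst (interior_bisector l l')" and ?g = "fst l + d + pi / 2"
  let ?w = "crossing_point l l'"
  have "[fst l' = fst l + 2 * d] (rmod (2 * pi))"
    using turn by (auto simp: rcong_altdef algebra_simps)
  then have "cis (fst l') = cis (fst l + 2 * d)"
    by (simp add: cis_eq_iff)
  then have diff: "cis (fst l') - cis (fst l) = of_real (2 * sin d) * cis ?g"
    by (simp only: cis_diff_half_angle)
  have "orienting_vector l' - orienting_vector l = of_real (2 * sin d) * (\<i> * cis ?g)"
    unfolding orienting_vector_def right_diff_distrib[symmetric] diff by simp
  \<comment> \<open>Positivity of \<open>sin d\<close> fixes the orientation: a negative factor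
    would reverse the bisector.\<close>
  moreover have "sgn (of_real (2 * sin d) * (\<i> * cis ?g)) = \<i> * cis ?g"
    using pos by (simp add: sgn_eq norm_mult)
  ultimately have cis: "cis ?\<theta> = cis ?g"
    using orienting_vector_interior_bisector[OF cross] by (simp add: orienting_vector_def)
  then show "[?\<theta> = ?g] (rmod (2 * pi))"
    by (simp add: cis_eq_iff)
  have on: "Re ?w * cos (fst l) + Im ?w * sin (fst l) = snd l"
    "Re ?w * cos (fst l') + Im ?w * sin (fst l') = snd l'"
    using crossing_point_in[OF cross] by (auto simp: line_points_def)
  have comp: "cos (fst l') - cos (fst l) = 2 * sin d * cos ?\<theta>"
    "sin (fst l') - sin (fst l) = 2 * sin d * sin ?\<theta>"
    using diff unfolding cis[symmetric] by (auto simp: complex_eq_iff)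
  \<comment> \<open>Subtract the two line equations at the common point \<open>?w\<close>; by
    \<open>comp\<close> the difference of normals is a multiple of the bisector's normal.\<close>
  have "snd l' - snd l
      = Re ?w * (cos (fst l') - cos (fst l)) + Im ?w * (sin (fst l') - sin (fst l))"
    using on by (simp add: algebra_simps)
  also have "\<dots> = 2 * sin d * (Re ?w * cos ?\<theta> + Im ?w * sin ?\<theta>)"
    unfolding comp by (simp add: algebra_simps)
  also have "Re ?w * cos ?\<theta> + Im ?w * sin ?\<theta> = snd (interior_bisector l l')"
    by (simp add: interior_bisector_def Let_def)
  finally show "snd (interior_bisector l l') = (snd l' - snd l) / (2 * sin d)"
    using pos by simp
qed

lemma hypocycloid_periodic:
  assumes "hypocycloid m z h"
  shows "h (x + 2 * pi) = h x"
proof -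
  have "cos (real m * (x + 2 * pi)) = cos (real m * x)"
    "sin (real m * (x + 2 * pi)) = sin (real m * x)"
    \<comment> \<open>The order \<open>m\<close> is an integer, so the argument shifts by
      \<open>m\<close> full turns.\<close>
    using sin_cos_eq_iff[of "real m * (x + 2 * pi)" "real m * x"]
    by (auto simp: algebra_simps intro!: exI[of _ "int m"])
  then show ?thesis
    using assms by (auto simp: hypocycloid_def point_support_def)
qed

lemma harmonic_central_difference:
  fixes a b k x d :: real
  shows "(a * cos (k * (x + d)) + b * sin (k * (x + d)))
       - (a * cos (k * (x - d)) + b * sin (k * (x - d)))
       = 2 * sin (k * d) * (b * cos (k * x) - a * sin (k * x))"
  by (simp add: distrib_left right_diff_distrib cos_add sin_add cos_diff sin_diff)

lemma hypocycloid_central_difference: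
  assumes h: "hypocycloid m z h" and "m \<ge> 1" and "sin d \<noteq> 0"
  shows "(h (x + d) - h (x - d)) / (2 * sin d)
       = scale_about z (sin (real m * d) / (real m * sin d)) (evolute h) (x + pi / 2)"
proof -
  obtain a b where h: "h = (\<lambda>\<alpha>. point_support z \<alpha> + (a * cos (real m * \<alpha>) + b * sin (real m * \<alpha>)))"
    using h unfolding hypocycloid_def by blast
  let ?D = "\<lambda>k a b. b * cos (k * x) - a * sin (k * x)"
  have "deriv h x = ?D 1 (Re z) (Im z) + real m * ?D (real m) a b"
    unfolding h point_support_def
    by (rule DERIV_imp_deriv) (auto intro!: derivative_eq_intros simp: algebra_simps)
  then have "evolute h (x + pi / 2) = ?D 1 (Re z) (Im z) + real m * ?D (real m) a b"
    by (simp add: evolute_def)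
  moreover have "point_support z (x + pi / 2) = ?D 1 (Re z) (Im z)"
    by (simp add: point_support_def sin_add cos_add)
  moreover have "h (x + d) - h (x - d)
      = 2 * sin d * ?D 1 (Re z) (Im z) + 2 * sin (real m * d) * ?D (real m) a b"
    \<comment> \<open>The center contributes the harmonic with \<open>k = 1\<close>.\<close>
    using harmonic_central_difference[of "Re z" 1 x d "Im z"]
      harmonic_central_difference[of a "real m" x d b]
    by (simp add: h point_support_def)
  \<comment> \<open>\<open>A\<close> comes from the center and is fixed by scaling about
    \<open>z\<close>; on \<open>B\<close> the factor \<open>m\<close> from differentiation cancels
    the \<open>m\<close> in the denominator.\<close>
  moreover have "(2 * sin d * A + 2 * t * B) / (2 * sin d)
      = A + t / (real m * sin d) * (A + real m * B - A)" for t A B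
    using assms(2,3) by (simp add: add_divide_distrib)
  ultimately show ?thesis
    unfolding scale_about_def by (simp only:)
qed

theorem theorem8:
  fixes P :: "cline list" and h :: support_function and m n :: nat and z :: complex
  assumes "length P = n" and "n \<ge> 3" and "m \<ge> 1"
    and "equiangular_hedgehog P"
    and "hypocycloid m z h"
    and "polygon_tangent_to P h"
  shows "polygon_tangent_to (oriented_bisector_evolute P)
           (scale_about z (sin (pi * real m / real n) / (real m * sin (pi / real n)))
             (evolute h))"
proof -
  define d where "d = pi / real n"
  define H where "H = scale_about z (sin (real m * d) / (real m * sin d)) (evolute h)"
  have "0 < d" "d < pi"
    using \<open>n \<ge> 3\<close> by (auto simp: d_def field_simps)
  then have pos: "sin d > 0"
    by (rule sin_gt_zero)
  \<comment> \<open>The evolute is again a hypocycloid of order \<open>m\<close> centered at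
    \<open>z\<close>.\<close>
  have per_H: "H (x + 2 * pi) = H x" for x
    using hypocycloid_periodic[OF hypocycloid_evolute[OF assms(5)]]
    by (simp add: H_def scale_about_def point_support_def)
  have "line_tangent_to (interior_bisector (P ! j) (P ! (Suc j mod length P))) H"
    if j: "j < length P" for j
  proof -
    define l where "l = P ! j"
    define l' where "l' = P ! (Suc j mod length P)"
    have "Suc j mod length P < length P"
      using j by (intro mod_less_divisor) auto
    then have p: "snd l = h (fst l)" "snd l' = h (fst l')"
      using assms(6) j by (auto simp: polygon_tangent_to_def line_tangent_to_def l_def l'_def)
    have cross: "crossing l l'"
      and turn: "[fst l' - fst l = 2 * d] (rmod (2 * pi))"
      using assms(1,4) j
      by (auto simp: equiangular_hedgehog_def cooriented_polygon_def l_def l'_def d_def)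
    note bisector = interior_bisector_of_turning_angle[OF cross turn pos]
    \<comment> \<open>Both side angles are written around the midpoint \<open>fst l + d\<close>,
      ready for the central difference.\<close>
    have "[fst l' = fst l + d + d] (rmod (2 * pi))"
      using turn by (auto simp: rcong_altdef algebra_simps)
    then have "snd l' = h (fst l + d + d)"
      using rcong_imp_periodic_eq[of h, OF hypocycloid_periodic[OF assms(5)]] p by simp
    then have "snd (interior_bisector l l')
        = (h (fst l + d + d) - h (fst l + d - d)) / (2 * sin d)"
      using bisector(2) p by simp
    also have "\<dots> = H (fst l + d + pi / 2)"
      unfolding H_def using pos assms(3,5) by (intro hypocycloid_central_difference) auto
    also have "\<dots> = H (fst (interior_bisector l l'))"
      using rcong_imp_periodic_eq[of H, OF per_H bisector(1)] by simp
    finally show ?thesis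
      by (simp add: line_tangent_to_def l_def l'_def)
  qed
  then show ?thesis
    by (auto simp: polygon_tangent_to_def oriented_bisector_evolute_def H_def d_def mult.commute)
qed

end
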